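(* Let $I\subset\mathbb{R}$ be an open interval and let $\gamma:I\to\mathbb{R}^2\setminus\{0\}$ be a smooth unit speed plane curve with unit normal $n$ such that $\langle\gamma(s),n(s)\rangle\neq0$ for all $s\in I$. Then for all $s\in I$ $$\mathrm{Pr}_{\gamma}(s)=\mathrm{APe}_{\Psi\circ\gamma}(s)\quad\text{and}\quad \mathrm{Pr}_{\Psi\circ\gamma}(s)=\mathrm{APe}_{\gamma}(s).$$
   Context: $J=\begin{pmatrix}0&-1\\1&0\end{pmatrix}$. For a smooth regular curve $c:I\to\mathbb{R}^2$ (not necessarily unit speed), the unit tangent is $t_c=c'/\|c'\|$ and the unit normal is $n_c=Jt_c$ (for $\gamma$, $n=n_\gamma$). Inversion: $\Psi:\mathbb{R}^2\setminus\{0\}\to\mathbb{R}^2\setminus\{0\}$, $\Psi(x)=x/\|x\|^2$. Let $c:I\to\mathbb{R}^2\setminus\{0\}$ be regular with $\langle c,n_c\rangle\ne0$ on $I$. Primitive: $\mathrm{Pr}_c$ is the envelope of the family of lines $\{x:\langle x-c(s),c(s)\rangle=0\}_{s\in I}$, i.e. $\mathrm{Pr}_c(s)$ is the unique point $x$ with $H(s,x)=\frac{\partial H}{\partial s}(s,x)=0$ where $H(s,x)=\langle x-c(s),c(s)\rangle$. Explicitly, $$\mathrm{Pr}_c(s)=2c(s)-\frac{\|c(s)\|^2}{\langle n_c(s),c(s)\rangle}n_c(s).$$ Anti-pedal: $\mathrm{APe}_c(s)=\frac{1}{\langle c(s),n_c(s)\rangle}n_c(s)$. *)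

theory Defs
  imports "HOL-Analysis.Analysis"
begin

(* Intended for open S only: the derivatives are two-sided ones. *)
definition smooth_curve_on :: "real set \<Rightarrow> (real \<Rightarrow> real^2) \<Rightarrow> bool" where
  "smooth_curve_on S c \<longleftrightarrow>
     (\<forall>k. \<forall>s\<in>S. ((\<lambda>f t. vector_derivative f (at t)) ^^ k) c differentiable at s)"

definition J :: "real^2^2" where
  "J = vector [vector [0, -1], vector [1, 0]]"

definition unit_tangent :: "(real \<Rightarrow> real^2) \<Rightarrow> real \<Rightarrow> real^2" where
  "unit_tangent c s = vector_derivative c (at s) /\<^sub>R norm (vector_derivative c (at s))"

definition unit_normal :: "(real \<Rightarrow> real^2) \<Rightarrow> real \<Rightarrow> real^2" where
  "unit_normal c s = J *v unit_tangent c s"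

definition inversion :: "real^2 \<Rightarrow> real^2" where
  "inversion x = x /\<^sub>R (norm x)\<^sup>2"

definition primitive_family :: "(real \<Rightarrow> real^2) \<Rightarrow> real \<Rightarrow> real^2 \<Rightarrow> real" where
  "primitive_family c s x = (x - c s) \<bullet> c s"

(* Point of contact of the line primitive_family c s x = 0 with the envelope of the family.
   It is unique, so that THE is meaningful, if c is regular at s and c s \<bullet> unit_normal c s \<noteq> 0. *)
definition primitive :: "(real \<Rightarrow> real^2) \<Rightarrow> real \<Rightarrow> real^2" where
  "primitive c s = (THE x. primitive_family c s x = 0 \<and>
     ((\<lambda>t. primitive_family c t x) has_real_derivative 0) (at s))"

definition anti_pedal :: "(real \<Rightarrow> real^2) \<Rightarrow> real \<Rightarrow> real^2" where
  "anti_pedal c s = (1 / (c s \<bullet> unit_normal c s)) *\<^sub>R unit_normal c s"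

end

theory Submission
  imports Defs
begin

text \<open>
  Where \<open>c\<close> and \<open>c'\<close> are linearly independent, a point \<open>x\<close> is determined by its inner products
  with them: the primitive by \<open>x \<bullet> c = c \<bullet> c\<close> and \<open>x \<bullet> c' = 2 (c \<bullet> c')\<close>, the anti-pedal by
  \<open>x \<bullet> c = 1\<close> and \<open>x \<bullet> c' = 0\<close>. Differentiating \<open>\<Psi> \<circ> c\<close> turns the second system for \<open>\<Psi> \<circ> c\<close>
  into the first one for \<open>c\<close>, which is the first identity. The second identity is the first one
  for \<open>\<Psi> \<circ> c\<close>, because \<open>\<Psi>\<close> is an involution.
\<close>

lemma J_mult: "J *v x = vector [- x $ 2, x $ 1]"
  by (simp add: J_def vec_eq_iff forall_2 matrix_vector_mult_def sum_2)

lemma inner_real2: "x \<bullet> y = x $ 1 * y $ 1 + x $ 2 * y $ 2" for x y :: "real^2"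
  by (simp add: inner_vec_def sum_2)

lemma inner_J_self: "x \<bullet> (J *v x) = 0"
  by (simp add: J_mult inner_real2)

text \<open>Up to sign, \<open>p \<bullet> (J *v q)\<close> is the determinant of \<open>p\<close>
  and \<open>q\<close>. Being nonzero, it makes them a basis of the plane, and only the zero vector
  is orthogonal to both.\<close>

lemma inner_J_eqI:
  assumes "p \<bullet> (J *v q) \<noteq> 0" "x \<bullet> p = y \<bullet> p" "x \<bullet> q = y \<bullet> q"
  shows "x = y"
proof -
  define z where "z = x - y"
  have z: "z $ 1 * p $ 1 + z $ 2 * p $ 2 = 0" "z $ 1 * q $ 1 + z $ 2 * q $ 2 = 0"
    using assms(2,3) by (simp_all add: z_def inner_real2 algebra_simps)
  have D: "p $ 2 * q $ 1 - p $ 1 * q $ 2 \<noteq> 0"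
    using assms(1) by (simp add: J_mult inner_real2)
  \<comment> \<open>Cramer's rule: eliminating one coordinate of \<open>z\<close> from the two
    equations leaves the determinant times the other.\<close>
  have "z $ 1 * (p $ 2 * q $ 1 - p $ 1 * q $ 2) = 0" "z $ 2 * (p $ 2 * q $ 1 - p $ 1 * q $ 2) = 0"
    using z by algebra+
  then have "z = 0"
    using D by (simp add: vec_eq_iff forall_2)
  then show ?thesis by (simp add: z_def)
qed

text \<open>The scaling factors of the two applications cancel. The identity also holds at the
  origin, where \<open>inversion 0 = 0\<close>, so it can rewrite under a composition without side
  conditions.\<close>

lemma inversion_inversion: "inversion (inversion x) = x"
  by (cases "x = 0") (simp_all add: inversion_def power2_eq_square field_simps)

lemma unit_normal_eq:
  assumes "(c has_vector_derivative c') (at s)"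
  shows "unit_normal c s = (J *v c') /\<^sub>R norm c'"
  using assms
  by (simp add: unit_normal_def unit_tangent_def vector_derivative_at matrix_vector_mult_scaleR)

text \<open>Passing from the unit normal to \<open>J *v c'\<close> only drops the factor
  \<open>1 / norm c'\<close>; if \<open>c' = 0\<close>, both inner products vanish. This turns the
  geometric hypothesis into linear independence of \<open>c s\<close> and \<open>c'\<close>.\<close>

lemma inner_unit_normal_nonzero_iff:
  assumes "(c has_vector_derivative c') (at s)"
  shows "c s \<bullet> unit_normal c s \<noteq> 0 \<longleftrightarrow> c s \<bullet> (J *v c') \<noteq> 0"
  by (auto simp: unit_normal_eq[OF assms])

lemma anti_pedal_eqI:
  assumes c: "(c has_vector_derivative c') (at s)"
    and indep: "c s \<bullet> (J *v c') \<noteq> 0"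
    and "x \<bullet> c s = 1" "x \<bullet> c' = 0"
  shows "anti_pedal c s = x"
proof (rule inner_J_eqI[OF indep])
  have "c s \<bullet> unit_normal c s \<noteq> 0"
    using indep inner_unit_normal_nonzero_iff[OF c] by blast
  then show "anti_pedal c s \<bullet> c s = x \<bullet> c s"
    using assms(3) by (simp add: anti_pedal_def inner_commute)
  show "anti_pedal c s \<bullet> c' = x \<bullet> c'"
    using assms(4) inner_J_self[of c']
    by (simp add: anti_pedal_def unit_normal_eq[OF c] inner_commute)
qed

lemma primitive_family_has_derivative:
  assumes "(c has_vector_derivative c') (at s)"
  shows "((\<lambda>t. primitive_family c t x) has_real_derivative x \<bullet> c' - 2 * (c s \<bullet> c')) (at s)"
  unfolding primitive_family_def has_real_derivative_iff_has_vector_derivative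
    has_vector_derivative_def
  by (rule derivative_eq_intros assms[unfolded has_vector_derivative_def] refl)+
    (simp add: fun_eq_iff algebra_simps inner_commute)

text \<open>Since derivatives are unique, the two conditions under \<open>THE\<close> amount to the
  two linear equations for \<open>x\<close>, which independence makes uniquely solvable.\<close>

lemma primitive_eqI:
  assumes c: "(c has_vector_derivative c') (at s)"
    and indep: "c s \<bullet> (J *v c') \<noteq> 0"
    and x: "x \<bullet> c s = c s \<bullet> c s" "x \<bullet> c' = 2 * (c s \<bullet> c')"
  shows "primitive c s = x"
  unfolding primitive_def
proof (rule the_equality)
  show "primitive_family c s x = 0 \<and>
      ((\<lambda>t. primitive_family c t x) has_real_derivative 0) (at s)"
    using x primitive_family_has_derivative[OF c, of x]
    by (simp add: primitive_family_def inner_diff_left)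
next
  fix y
  assume y: "primitive_family c s y = 0 \<and>
      ((\<lambda>t. primitive_family c t y) has_real_derivative 0) (at s)"
  then have "y \<bullet> c' - 2 * (c s \<bullet> c') = 0"
    using DERIV_unique primitive_family_has_derivative[OF c] by blast
  with x y show "y = x"
    by (intro inner_J_eqI[OF indep]) (simp_all add: primitive_family_def inner_diff_left)
qed

lemma inversion_has_vector_derivative:
  assumes c: "(c has_vector_derivative c') (at s)" and "c s \<noteq> 0"
  shows "(inversion \<circ> c has_vector_derivative
      c' /\<^sub>R (c s \<bullet> c s) - (2 * (c s \<bullet> c') / (c s \<bullet> c s)\<^sup>2) *\<^sub>R c s) (at s)"
proof -
  have "((\<lambda>t. c t \<bullet> c t) has_real_derivative 2 * (c s \<bullet> c')) (at s)"
    unfolding has_real_derivative_iff_has_vector_derivative has_vector_derivative_def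
    by (rule derivative_eq_intros c[unfolded has_vector_derivative_def] refl)+
      (simp add: fun_eq_iff inner_commute)
  from DERIV_inverse_fun[OF this]
  have "((\<lambda>t. inverse (c t \<bullet> c t)) has_real_derivative
      - (2 * (c s \<bullet> c') / (c s \<bullet> c s)\<^sup>2)) (at s)"
    using assms(2) by (simp add: field_simps power2_eq_square)
  then have "((\<lambda>t. inverse (c t \<bullet> c t) *\<^sub>R c t) has_vector_derivative
      inverse (c s \<bullet> c s) *\<^sub>R c' + (- (2 * (c s \<bullet> c') / (c s \<bullet> c s)\<^sup>2)) *\<^sub>R c s) (at s)"
    by (rule has_vector_derivative_scaleR[OF _ c])
  then show ?thesis
    by (simp add: comp_def inversion_def power2_norm_eq_inner)
qed

text \<open>Inversion preserves nondegeneracy: the part of \<open>b'\<close> along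
  \<open>c s\<close> contributes nothing because \<open>c s \<bullet> (J *v c s) = 0\<close>, so the
  new inner product is the old one divided by the square of
  \<open>c s \<bullet> c s\<close>.\<close>

lemma inversion_inner_J_nonzero:
  assumes c: "(c has_vector_derivative c') (at s)" and indep: "c s \<bullet> (J *v c') \<noteq> 0"
  obtains b' where "(inversion \<circ> c has_vector_derivative b') (at s)"
    and "(inversion \<circ> c) s \<bullet> (J *v b') \<noteq> 0"
    and "b' = c' /\<^sub>R (c s \<bullet> c s) - (2 * (c s \<bullet> c') / (c s \<bullet> c s)\<^sup>2) *\<^sub>R c s"
proof -
  have "c s \<noteq> 0" using indep by auto
  then show ?thesis
    using indep inner_J_self[of "c s"]
    by (intro that[OF inversion_has_vector_derivative[OF c]])
      (auto simp: inversion_def matrix_vector_mult_diff_distrib matrix_vector_mult_scaleR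
        inner_diff_right)
qed

text \<open>The speed of \<open>c\<close> is left arbitrary so that the result also applies to the
  inverted curve, which in general does not have unit speed.\<close>

lemma primitive_eq_anti_pedal_inversion:
  assumes c: "(c has_vector_derivative c') (at s)" and indep: "c s \<bullet> (J *v c') \<noteq> 0"
  shows "primitive c s = anti_pedal (inversion \<circ> c) s"
proof -
  have nz: "c s \<noteq> 0" using indep by auto
  obtain b' where b: "(inversion \<circ> c has_vector_derivative b') (at s)"
      "(inversion \<circ> c) s \<bullet> (J *v b') \<noteq> 0"
    and b': "b' = c' /\<^sub>R (c s \<bullet> c s) - (2 * (c s \<bullet> c') / (c s \<bullet> c s)\<^sup>2) *\<^sub>R c s"
    by (rule inversion_inner_J_nonzero[OF assms])
  \<comment> \<open>The candidate \<open>x\<close> is the explicit formula for the primitive with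
    \<open>J *v c'\<close> in place of the unit normal; the formula does not change when the normal
    is rescaled.\<close>
  define k where "k = 1 / (c s \<bullet> (J *v c'))"
  define x where "x = 2 *\<^sub>R c s - (k * (c s \<bullet> c s)) *\<^sub>R (J *v c')"
  have x: "x \<bullet> c s = c s \<bullet> c s" "x \<bullet> c' = 2 * (c s \<bullet> c')"
    using indep inner_J_self[of c']
    by (simp_all add: x_def k_def inner_diff_left inner_diff_right inner_commute)
  have "primitive c s = x"
    by (rule primitive_eqI[OF assms x])
  \<comment> \<open>The equation \<open>x \<bullet> c s = c s \<bullet> c s\<close> gives inner
    product 1 with the inverted point. In \<open>x \<bullet> b'\<close> the two terms both equal
    \<open>2 * (c s \<bullet> c') / (c s \<bullet> c s)\<close> and cancel.\<close>
  moreover have "anti_pedal (inversion \<circ> c) s = x"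
    using x nz
    by (intro anti_pedal_eqI[OF b])
      (simp_all add: b' inversion_def inner_diff_right power2_norm_eq_inner,
        simp_all add: power2_eq_square field_simps)
  ultimately show ?thesis by simp
qed

theorem proposition2p1:
  fixes I :: "real set" and \<gamma> :: "real \<Rightarrow> real^2"
  assumes "open I" and "is_interval I"
    and "smooth_curve_on I \<gamma>"
    and "\<forall>s\<in>I. \<gamma> s \<noteq> 0"
    and "\<forall>s\<in>I. norm (vector_derivative \<gamma> (at s)) = 1"
    and "\<forall>s\<in>I. \<gamma> s \<bullet> unit_normal \<gamma> s \<noteq> 0"
  shows "\<forall>s\<in>I. primitive \<gamma> s = anti_pedal (inversion \<circ> \<gamma>) s \<and>
                primitive (inversion \<circ> \<gamma>) s = anti_pedal \<gamma> s"
proof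
  fix s assume s: "s \<in> I"
  have "((\<lambda>f t. vector_derivative f (at t)) ^^ 0) \<gamma> differentiable at s"
    using assms(3) s unfolding smooth_curve_on_def by blast
  then have d: "(\<gamma> has_vector_derivative vector_derivative \<gamma> (at s)) (at s)"
    by (simp add: vector_derivative_works)
  have indep: "\<gamma> s \<bullet> (J *v vector_derivative \<gamma> (at s)) \<noteq> 0"
    using assms(6) s inner_unit_normal_nonzero_iff[OF d] by blast
  obtain b' where "(inversion \<circ> \<gamma> has_vector_derivative b') (at s)"
      "(inversion \<circ> \<gamma>) s \<bullet> (J *v b') \<noteq> 0"
    by (rule inversion_inner_J_nonzero[OF d indep])
  then have "primitive (inversion \<circ> \<gamma>) s = anti_pedal (inversion \<circ> (inversion \<circ> \<gamma>)) s"
    by (rule primitive_eq_anti_pedal_inversion)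
  then show "primitive \<gamma> s = anti_pedal (inversion \<circ> \<gamma>) s \<and>
      primitive (inversion \<circ> \<gamma>) s = anti_pedal \<gamma> s"
    using primitive_eq_anti_pedal_inversion[OF d indep]
    by (simp add: comp_def inversion_inversion)
qed

end
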